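(* For every real number $\epsilon>0$ there exists a constant $C_\epsilon$ such that for all sufficiently large integers $m$ there is a supersequence of length $$\left\lceil m^2-\left(\tfrac52-\epsilon\right)m+C_\epsilon\right\rceil$$ over a set of $m$ letters.
   Context: A supersequence over a finite set $A$ is a finite sequence of elements of $A$ that contains every permutation of $A$ (every sequence listing each element of $A$ exactly once) as a subsequence, i.e. each permutation can be obtained from it by deleting zero or more elements and keeping the order of the others. *)

theory Defs
  imports Complex_Main "HOL-Library.Sublist" "HOL-Combinatorics.Multiset_Permutations"
begin

text \<open>The library's \<^const>\<open>subseq\<close> allows deletions at arbitrary positions, so the subsequence
  need not be contiguous.\<close>

definition supersequence :: "'a set \<Rightarrow> 'a list \<Rightarrow> bool" where
  "supersequence A w \<longleftrightarrow>
     finite A \<and> set w \<subseteq> A \<and> (\<forall>p \<in> permutations_of_set A. subseq p w)"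

end

theory Submission
  imports Defs
begin

text \<open>
  Let \<open>q = m - 4\<close>. The word runs cyclically through \<open>q + 1\<close> base letters, and three special letters
  \<open>x, y, z\<close> (numbered \<open>q + 1, q + 2, q + 3\<close>) are inserted after some of them. Cut the base letters
  into blocks of length \<open>q\<close>. Following a permutation greedily, each base letter costs at most one
  block, because the letter just read does not occur again; so a permutation takes \<open>q + 1\<close> blocks
  plus the blocks lost while waiting for the special letters. In a block, a special letter follows
  the base letter at one of the offsets \<open>0, \<dots>, 6\<close>: the letter \<open>x\<close> at \<open>3\<close> in every block, while \<open>y\<close>
  (offsets \<open>1, 4, 6\<close>) and \<open>z\<close> (offsets \<open>0, 2, 5\<close>) climb through three blocks and skip every fourth.
  A letter is late before it is skipped and early afterwards, so a wait of two blocks starts only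
  from a high offset and ends at a low one, from where \<open>x\<close> comes for free. A potential argument
  shows that at most two blocks are lost in total. A block contains \<open>5/2\<close> special letters on
  average, so the length is \<open>q (q + 3) + 5/2 q + O(1) = m\<^sup>2 - 5/2 m + O(1)\<close>.
\<close>

section \<open>The word, its suffixes and greedy matching\<close>

definition gap :: "nat \<Rightarrow> nat \<Rightarrow> nat list" where
  "gap q j = (let t = j div q mod 4; d = j mod q in
     if d = 3 then [q + 1]
     else if (t, d) \<in> {(0, 1), (1, 4), (2, 6)} then [q + 2]
     else if (t, d) \<in> {(0, 0), (1, 2), (2, 5)} then [q + 3]
     else [])"

definition word_from :: "nat \<Rightarrow> nat \<Rightarrow> nat \<Rightarrow> nat list" where
  "word_from q N i = concat (map (\<lambda>j. j mod Suc q # gap q j) [i..<N])"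

lemma word_from_Cons:
  "i < N \<Longrightarrow> word_from q N i = i mod Suc q # gap q i @ word_from q N (Suc i)"
  by (simp add: word_from_def upt_conv_Cons)

lemma subseq_word_from:
  assumes "i \<le> i'"
  shows "subseq (word_from q N i') (word_from q N i)"
proof (cases "i' \<le> N")
  case True
  with assms have "[i..<N] = [i..<i'] @ [i'..<N]"
    by (metis le_Suc_ex upt_add_eq_append)
  then show ?thesis
    by (simp add: word_from_def list_emb_append2)
qed (simp add: word_from_def)

text \<open>The base letters at \<open>i\<close>, ..., \<open>i + q\<close> are all different, so
  one of them is \<open>c\<close>. The cost is \<open>q\<close> rather than \<open>q + 1\<close>
  because \<open>c\<close> does not recur: if it is met only at \<open>i + q\<close>, then
  \<open>p\<close> may still be embedded from \<open>i + q\<close> on without using that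
  letter.\<close>

lemma subseq_word_from_base:
  assumes p: "subseq p (word_from q N (i + q))" and "c \<notin> set p" "c \<le> q" "i + q < N"
  shows "subseq (c # p) (word_from q N i)"
proof -
  \<comment> \<open>The first index from \<open>i\<close> on that carries \<open>c\<close>; the
    added \<open>Suc q\<close> keeps the subtraction from truncating.\<close>
  define h where "h = i + (c + Suc q - i mod Suc q) mod Suc q"
  have "(c + Suc q - i mod Suc q) mod Suc q < Suc q" by simp
  then have h: "i \<le> h" "h \<le> i + q" "h < N"
    using \<open>i + q < N\<close> unfolding h_def by linarith+
  have "h mod Suc q = (i mod Suc q + (c + Suc q - i mod Suc q)) mod Suc q"
    unfolding h_def by (metis mod_add_eq mod_mod_trivial)
  also have "i mod Suc q + (c + Suc q - i mod Suc q) = c + Suc q"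
    using mod_less_divisor[of "Suc q" i] by linarith
  also have "(c + Suc q) mod Suc q = c"
    using \<open>c \<le> q\<close> by (simp del: add_Suc_right)
  finally have hc: "h mod Suc q = c" .
  have "subseq p (word_from q N h)"
    using p subseq_word_from[OF h(2)] subseq_order.order_trans by blast
  then have "subseq p (gap q h @ word_from q N (Suc h))"
    using \<open>c \<notin> set p\<close> by (cases p) (auto simp: word_from_Cons[OF h(3)] hc)
  then have "subseq (c # p) (word_from q N h)"
    by (simp add: word_from_Cons[OF h(3)] hc)
  then show ?thesis
    using subseq_word_from[OF h(1)] subseq_order.order_trans by blast
qed

lemma subseq_word_from_gap:
  assumes p: "subseq p (word_from q N (Suc h))" and "gap q h = [s]" "i \<le> h" "h < N"
  shows "subseq (s # p) (word_from q N i)"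
proof -
  have "subseq (s # p) (word_from q N h)"
    using p assms(2) by (auto simp: word_from_Cons[OF \<open>h < N\<close>] intro: list_emb_Cons)
  then show ?thesis
    using subseq_word_from[OF \<open>i \<le> h\<close>] subseq_order.order_trans by blast
qed

lemma gap_block:
  assumes "d < q"
  shows "gap q (q * t + d) =
    (if d = 3 then [q + 1]
     else if (t mod 4, d) \<in> {(0, 1), (1, 4), (2, 6)} then [q + 2]
     else if (t mod 4, d) \<in> {(0, 0), (1, 2), (2, 5)} then [q + 3]
     else [])"
  using assms by (simp add: gap_def Let_def)

section \<open>Potential for the lost blocks\<close>

text \<open>\<open>pot X Y Z r\<close> bounds the blocks still to be lost at offset \<open>r\<close>, where \<open>X\<close>, \<open>Y\<close>, \<open>Z\<close> tell which
  special letters are still to come. The thresholds come from a computer search over all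
  continuations.\<close>

definition threshold :: "bool \<Rightarrow> bool \<Rightarrow> bool \<Rightarrow> nat" where
  "threshold X Y Z =
    (if X then if Y then if Z then 1 else 2 else if Z then 3 else 4
     else if Y then if Z then 5 else 7 else if Z then 6 else 8)"

definition pot :: "bool \<Rightarrow> bool \<Rightarrow> bool \<Rightarrow> nat \<Rightarrow> nat" where
  "pot X Y Z r = of_bool Y + of_bool Z + of_bool (threshold X Y Z \<le> r)"

text \<open>Here \<open>l\<close> blocks are lost. The bound on \<open>d\<close> makes the next
  offset \<open>Suc d\<close> at most 7.\<close>

definition reaches :: "nat \<Rightarrow> nat \<Rightarrow> nat \<Rightarrow> nat \<Rightarrow> nat \<Rightarrow> nat \<Rightarrow> bool" where
  "reaches q s t r l d \<longleftrightarrow> d \<le> 6 \<and> (l = 0 \<longrightarrow> r \<le> d) \<and> gap q (q * (t + l) + d) = [s]"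

text \<open>All thresholds with \<open>x\<close> pending are at most 4, all others exceed 4. So a
  wait is paid by the indicator in \<open>pot\<close>, and offset 4 leaves it off.\<close>

lemma reaches_x:
  assumes "7 \<le> q"
  shows "\<exists>l d. reaches q (q + 1) t r l d \<and> l + pot False Y Z (Suc d) \<le> pot True Y Z r"
proof -
  have gap: "gap q (q * t' + 3) = [q + 1]" for t'
    using assms by (subst gap_block) auto
  show ?thesis
  proof (cases "r \<le> 3")
    case True
    then show ?thesis
      by (intro exI[of _ 0] exI[of _ 3]) (auto simp: reaches_def gap pot_def threshold_def)
  next
    case False
    then show ?thesis
      using gap[of "t + 1"]
      by (intro exI[of _ 1] exI[of _ 3]) (auto simp: reaches_def pot_def threshold_def)
  qed
qed

text \<open>Removing \<open>y\<close> frees one unit, which pays for one lost block or for the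
  indicator switching on. Two blocks are lost only from offset 7 when \<open>t mod 4 = 2\<close>;
  there the indicator is on, and the new offset 2 turns it off.\<close>

lemma reaches_y:
  assumes "7 \<le> q" "r \<le> 7"
  shows "\<exists>l d. reaches q (q + 2) t r l d \<and> l + pot X False Z (Suc d) \<le> pot X True Z r"
proof -
  have *: ?thesis
    if "((t + l) mod 4, d) \<in> {(0, 1), (1, 4), (2, 6)}" "l + pot X False Z (Suc d) \<le> pot X True Z r"
      "l = 0 \<longrightarrow> r \<le> d" for l d
  proof -
    have "d \<le> 6" "d \<noteq> 3" using that(1) by auto
    then have "gap q (q * (t + l) + d) = [q + 2]"
      using that(1) \<open>7 \<le> q\<close> by (subst gap_block) auto
    then show ?thesis
      using that(2,3) \<open>d \<le> 6\<close> by (intro exI[of _ l] exI[of _ d]) (simp add: reaches_def)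
  qed
  consider "t mod 4 = 0" | "t mod 4 = 1" | "t mod 4 = 2" | "t mod 4 = 3" by linarith
  then show ?thesis
  proof cases
    case 1
    then have next_block: "(t + 1) mod 4 = 1" by presburger
    show ?thesis
    proof (cases "r \<le> 1")
      case True
      with 1 show ?thesis by (intro *[of 0 1]) (auto simp: pot_def threshold_def)
    next
      case False
      with next_block show ?thesis by (intro *[of 1 4]) (auto simp: pot_def threshold_def)
    qed
  next
    case 2
    then have next_block: "(t + 1) mod 4 = 2" by presburger
    show ?thesis
    proof (cases "r \<le> 4")
      case True
      with 2 show ?thesis by (intro *[of 0 4]) (auto simp: pot_def threshold_def)
    next
      case False
      with next_block show ?thesis by (intro *[of 1 6]) (auto simp: pot_def threshold_def)
    qed
  next
    case 3
    then have next_block: "(t + 2) mod 4 = 0" by presburger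
    show ?thesis
    proof (cases "r \<le> 6")
      case True
      with 3 show ?thesis by (intro *[of 0 6]) (auto simp: pot_def threshold_def)
    next
      case False
      with next_block \<open>r \<le> 7\<close> show ?thesis by (intro *[of 2 1]) (auto simp: pot_def threshold_def)
    qed
  next
    case 4
    then have next_block: "(t + 1) mod 4 = 0" by presburger
    then show ?thesis
      by (intro *[of 1 1]) (auto simp: pot_def threshold_def)
  qed
qed

lemma reaches_z:
  assumes "7 \<le> q"
  shows "\<exists>l d. reaches q (q + 3) t r l d \<and> l + pot X Y False (Suc d) \<le> pot X Y True r"
proof -
  have *: ?thesis
    if "((t + l) mod 4, d) \<in> {(0, 0), (1, 2), (2, 5)}" "l + pot X Y False (Suc d) \<le> pot X Y True r"
      "l = 0 \<longrightarrow> r \<le> d" for l d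
  proof -
    have "d \<le> 6" "d \<noteq> 3" using that(1) by auto
    then have "gap q (q * (t + l) + d) = [q + 3]"
      using that(1) \<open>7 \<le> q\<close> by (subst gap_block) auto
    then show ?thesis
      using that(2,3) \<open>d \<le> 6\<close> by (intro exI[of _ l] exI[of _ d]) (simp add: reaches_def)
  qed
  consider "t mod 4 = 0" | "t mod 4 = 1" | "t mod 4 = 2" | "t mod 4 = 3" by linarith
  then show ?thesis
  proof cases
    case 1
    then have next_block: "(t + 1) mod 4 = 1" by presburger
    show ?thesis
    proof (cases "r = 0")
      case True
      with 1 show ?thesis by (intro *[of 0 0]) (auto simp: pot_def threshold_def)
    next
      case False
      with next_block show ?thesis by (intro *[of 1 2]) (auto simp: pot_def threshold_def)
    qed
  next
    case 2
    then have next_block: "(t + 1) mod 4 = 2" by presburger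
    show ?thesis
    proof (cases "r \<le> 2")
      case True
      with 2 show ?thesis by (intro *[of 0 2]) (auto simp: pot_def threshold_def)
    next
      case False
      with next_block show ?thesis by (intro *[of 1 5]) (auto simp: pot_def threshold_def)
    qed
  next
    case 3
    then have next_block: "(t + 2) mod 4 = 0" by presburger
    show ?thesis
    proof (cases "r \<le> 5")
      case True
      with 3 show ?thesis by (intro *[of 0 5]) (auto simp: pot_def threshold_def)
    next
      case False
      with next_block show ?thesis by (intro *[of 2 0]) (auto simp: pot_def threshold_def)
    qed
  next
    case 4
    then have next_block: "(t + 1) mod 4 = 0" by presburger
    then show ?thesis
      by (intro *[of 1 0]) (auto simp: pot_def threshold_def)
  qed
qed

text \<open>The budget is invariant: a base letter advances \<open>t\<close> by one and keeps
  \<open>r\<close>, a special letter advances \<open>t\<close> by at most the drop of the potential.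
  The spare 8 leaves room for offsets up to 7.\<close>

lemma subseq_word_from_pot:
  assumes "7 \<le> q" "distinct p" "set p \<subseteq> {..q + 3}" "r \<le> 7"
    and "q * (t + length (filter (\<lambda>c. c \<le> q) p)
           + pot (q + 1 \<in> set p) (q + 2 \<in> set p) (q + 3 \<in> set p) r) + 8 \<le> N"
  shows "subseq p (word_from q N (q * t + r))"
  using assms(2-)
proof (induction p arbitrary: t r)
  case (Cons c p)
  let ?b = "length (filter (\<lambda>c. c \<le> q) p)"
  let ?pot = "pot (q + 1 \<in> set p) (q + 2 \<in> set p) (q + 3 \<in> set p)"
  let ?pot' = "pot (q + 1 \<in> set (c # p)) (q + 2 \<in> set (c # p)) (q + 3 \<in> set (c # p)) r"
  show ?case
  proof (cases "c \<le> q")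
    case True
    then have bound: "q * (t + 1 + ?b + ?pot r) + 8 \<le> N"
      using Cons.prems(4) by (simp add: ac_simps)
    then have "subseq p (word_from q N (q * (t + 1) + r))"
      using Cons.prems by (intro Cons.IH) auto
    moreover have "q * (t + 1) \<le> q * (t + 1 + ?b + ?pot r)"
      by (intro mult_le_mono2) simp
    then have "q * t + r + q < N"
      using bound Cons.prems(3) distrib_left[of q t 1] by linarith
    ultimately show ?thesis
      using True Cons.prems(1) by (intro subseq_word_from_base) (auto simp: ac_simps)
  next
    case False
    then have "c = q + 1 \<or> c = q + 2 \<or> c = q + 3" using Cons.prems(2) by auto
    moreover have "c \<notin> set p" using Cons.prems(1) by simp
    ultimately have "\<exists>l d. reaches q c t r l d \<and> l + ?pot (Suc d) \<le> ?pot'"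
      using reaches_x[OF \<open>7 \<le> q\<close>] reaches_y[OF \<open>7 \<le> q\<close> Cons.prems(3)] reaches_z[OF \<open>7 \<le> q\<close>]
      by auto
    then obtain l d where ld: "reaches q c t r l d" "l + ?pot (Suc d) \<le> ?pot'" by blast
    let ?h = "q * (t + l) + d"
    have d: "d \<le> 6" "l = 0 \<longrightarrow> r \<le> d" "gap q ?h = [c]" using ld(1) by (auto simp: reaches_def)
    have "q * (t + l + ?b + ?pot (Suc d)) \<le> q * (t + ?b + ?pot')"
      using ld(2) by (intro mult_le_mono2) simp
    moreover have "q * (t + ?b + ?pot') + 8 \<le> N"
      using Cons.prems(4) False by simp
    ultimately have bound: "q * (t + l + ?b + ?pot (Suc d)) + 8 \<le> N"
      by (rule order_trans[OF add_right_mono])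
    then have "subseq p (word_from q N (q * (t + l) + Suc d))"
      using Cons.prems d(1) by (intro Cons.IH) auto
    moreover have "q * (t + l) \<le> q * (t + l + ?b + ?pot (Suc d))"
      by (intro mult_le_mono2) simp
    then have "?h < N"
      using bound d(1) by linarith
    \<comment> \<open>A later block lies ahead of the current position since
      \<open>r \<le> 7 \<le> q\<close>.\<close>
    moreover have "q * t + r \<le> ?h"
    proof (cases l)
      case (Suc k)
      then show ?thesis using Cons.prems(3) \<open>7 \<le> q\<close> by (simp add: algebra_simps)
    qed (use d(2) in simp)
    ultimately show ?thesis using d(3) by (intro subseq_word_from_gap) auto
  qed
qed simp

section \<open>Counting the letters\<close>

lemma length_gaps_block:
  assumes "7 \<le> q"
  shows "(\<Sum>j = t * q..<t * q + q. length (gap q j)) = (if t mod 4 = 3 then 1 else 3)"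
proof -
  define special :: "nat set" where
    "special = {3} \<union> (if t mod 4 = 0 then {0, 1} else if t mod 4 = 1 then {2, 4}
       else if t mod 4 = 2 then {5, 6} else {})"
  have "length (gap q (q * t + d)) = of_bool (d \<in> special)" if "d < q" for d
    unfolding gap_block[OF that] by (simp add: special_def)
  moreover have "(\<Sum>j = t * q..<t * q + q. length (gap q j)) = (\<Sum>d<q. length (gap q (q * t + d)))"
    using sum.shift_bounds_nat_ivl[of "\<lambda>j. length (gap q j)" 0 "t * q" q]
    by (simp add: atLeast0LessThan ac_simps)
  ultimately have "(\<Sum>j = t * q..<t * q + q. length (gap q j)) = (\<Sum>d<q. of_bool (d \<in> special))"
    by simp
  also have "\<dots> = card ({..<q} \<inter> special)"
    by simp
  also have "{..<q} \<inter> special = special"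
    using assms by (auto simp: special_def split: if_splits)
  also have "card special = (if t mod 4 = 3 then 1 else 3)"
    using mod_less_divisor[of 4 t] by (auto simp: special_def)
  finally show ?thesis .
qed

lemma length_gaps:
  assumes "7 \<le> q"
  shows "(\<Sum>j<4 * k * q. length (gap q j)) = 10 * k"
proof -
  have "(\<Sum>j<4 * k * q. length (gap q j)) = (\<Sum>t<4 * k. \<Sum>j = t * q..<t * q + q. length (gap q j))"
    by (rule sum.nat_group[symmetric])
  also have "\<dots> = (\<Sum>t<4 * k. if t mod 4 = 3 then 1 else 3)"
    by (intro sum.cong refl length_gaps_block assms)
  also have "\<dots> = 10 * k"
  proof (induction k)
    case (Suc k)
    have "4 * Suc k = Suc (Suc (Suc (Suc (4 * k))))" by simp
    with Suc show ?case by (simp only: sum.lessThan_Suc) (simp add: mod_Suc)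
  qed simp
  finally show ?thesis .
qed

lemma short_supersequence_atMost:
  assumes "7 \<le> q"
  shows "\<exists>w. supersequence {..q + 3} w \<and> 2 * length w \<le> 2 * q * q + 11 * q + 56"
proof -
  \<comment> \<open>There are \<open>q + 1\<close> base letters, and the potential at offset 0 is
    2.\<close>
  define N where "N = q * (q + 3) + 8"
  define w where "w = word_from q N 0"
  have "set (gap q j) \<subseteq> {..q + 3}" for j
    by (auto simp: gap_def Let_def)
  moreover have "j mod Suc q \<le> q + 3" for j
    using mod_less_divisor[of "Suc q" j] by linarith
  ultimately have "set w \<subseteq> {..q + 3}"
    by (fastforce simp: w_def word_from_def)
  moreover have "subseq p w" if "p \<in> permutations_of_set {..q + 3}" for p
  proof -
    have p: "set p = {..q + 3}" "distinct p"
      using that by (auto simp: permutations_of_set_def)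
    have "set (filter (\<lambda>c. c \<le> q) p) = {..q}" using p by auto
    then have "length (filter (\<lambda>c. c \<le> q) p) = q + 1"
      using p(2) distinct_card[of "filter (\<lambda>c. c \<le> q) p"] by simp
    then have "subseq p (word_from q N (q * 0 + 0))"
      using p assms by (intro subseq_word_from_pot) (auto simp: N_def pot_def threshold_def algebra_simps)
    then show ?thesis by (simp add: w_def)
  qed
  moreover have "2 * length w \<le> 2 * q * q + 11 * q + 56"
  proof -
    \<comment> \<open>Enough periods of four blocks, with 10 special letters each, to cover all
      \<open>N\<close> positions.\<close>
    define k where "k = (q + 8) div 4"
    have k: "q + 5 \<le> 4 * k" "4 * k \<le> q + 8" by (auto simp: k_def)
    have "N \<le> q * (q + 5)" using assms by (simp add: N_def algebra_simps)
    also have "\<dots> \<le> 4 * k * q" using k(1) by (simp add: mult.commute)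
    finally have N: "N \<le> 4 * k * q" .
    have "length w = N + (\<Sum>j<N. length (gap q j))"
      by (simp add: w_def word_from_def length_concat comp_def sum_list_Suc
          interv_sum_list_conv_sum_set_nat atLeast0LessThan)
    also have "(\<Sum>j<N. length (gap q j)) \<le> (\<Sum>j<4 * k * q. length (gap q j))"
      using N by (intro sum_mono2) auto
    also have "\<dots> = 10 * k" by (rule length_gaps[OF assms])
    finally show ?thesis using k(2) by (simp add: N_def algebra_simps)
  qed
  ultimately show ?thesis by (auto simp: supersequence_def)
qed

section \<open>Arbitrary alphabets and exact length\<close>

lemma supersequence_map:
  assumes "bij_betw f A B" "supersequence A w"
  shows "supersequence B (map f w)"
proof -
  have B: "B = f ` A" and inj: "inj_on f A" using assms(1) by (auto simp: bij_betw_def)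
  have "subseq p (map f w)" if "p \<in> permutations_of_set B" for p
  proof -
    let ?q = "map (inv_into A f) p"
    have p: "set p = B" "distinct p" using that by (auto simp: permutations_of_set_def)
    have "set ?q = A" using p(1) inj by (simp add: B inv_into_image_cancel)
    moreover have "distinct ?q"
      using p by (simp add: distinct_map B inj_on_inv_into)
    ultimately have "subseq ?q w"
      using assms(2) by (auto simp: supersequence_def permutations_of_set_def)
    then have "subseq (map f ?q) (map f w)" by (rule subseq_map)
    moreover have "map f ?q = p"
      using p(1) by (auto simp: B f_inv_into_f intro!: map_idI)
    ultimately show ?thesis by simp
  qed
  then show ?thesis using assms(2) by (auto simp: supersequence_def B)
qed

lemma supersequence_pad:
  assumes "supersequence A w" "a \<in> A" "length w \<le> l"
  shows "\<exists>w'. supersequence A w' \<and> length w' = l"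
proof -
  have "supersequence A (w @ replicate (l - length w) a)"
    using assms(1,2) by (auto simp: supersequence_def intro: list_emb_append2 subseq_order.order_trans)
  then show ?thesis using assms(3) by (intro exI[of _ "w @ replicate (l - length w) a"]) simp
qed

theorem corollary27:
  fixes \<epsilon> :: real
  assumes "\<epsilon> > 0"
  shows "\<exists>C :: real. \<forall>\<^sub>F m :: nat in sequentially.
           \<forall>A :: 'a set. finite A \<and> card A = m \<longrightarrow>
             (\<exists>w. supersequence A w \<and>
                  int (length w) = \<lceil>(real m)\<^sup>2 - (5 / 2 - \<epsilon>) * real m + C\<rceil>)"
proof (intro exI[of _ 22] eventually_sequentiallyI[of 11] allI impI)
  fix m :: nat and A :: "'a set"
  assume m: "11 \<le> m" and A: "finite A \<and> card A = m"
  let ?l = "\<lceil>(real m)\<^sup>2 - (5 / 2 - \<epsilon>) * real m + 22\<rceil>"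
  obtain q where q: "m = q + 4" "7 \<le> q"
    using m by (intro that[of "m - 4"]) auto
  obtain v where v: "supersequence {..q + 3} v" "2 * length v \<le> 2 * q * q + 11 * q + 56"
    using short_supersequence_atMost[OF q(2)] by blast
  have "{..q + 3} = {0..<m}" using q(1) by auto
  then obtain f where "bij_betw f {..q + 3} A"
    using A ex_bij_betw_nat_finite[of A] by auto
  then have w: "supersequence A (map f v)" using v(1) by (rule supersequence_map)
  have "2 * real (length v) \<le> 2 * real q * real q + 11 * real q + 56"
    using of_nat_mono[OF v(2), where ?'a = real] by simp
  \<comment> \<open>The constant 22 comes from substituting \<open>m = q + 4\<close>. It serves
    every \<epsilon>, since the term \<open>\<epsilon> * real m\<close> only raises the target
    length and padding fills the difference.\<close>
  also have "\<dots> = 2 * ((real m)\<^sup>2 - 5 / 2 * real m + 22)"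
    by (simp add: q(1) power2_eq_square algebra_simps)
  finally have "real (length v) \<le> (real m)\<^sup>2 - (5 / 2 - \<epsilon>) * real m + 22"
    using mult_nonneg_nonneg[OF less_imp_le[OF assms], of "real m"]
    unfolding left_diff_distrib by simp
  then have l: "int (length v) \<le> ?l"
    by (metis ceiling_mono ceiling_of_nat)
  obtain a where "a \<in> A" using A m by fastforce
  moreover have "length (map f v) \<le> nat ?l" using l by (simp add: le_nat_iff)
  ultimately obtain w' where "supersequence A w'" "length w' = nat ?l"
    using supersequence_pad[OF w] by blast
  then show "\<exists>w. supersequence A w \<and> int (length w) = ?l"
    using l by (intro exI[of _ w']) simp
qed

end
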